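(* For every $n\ge1$, $L(K_n)\le 6$.
   Context: $K_n$ is the complete graph on $n$ vertices. For a finite simple graph $G$ with $m$ edges, the symmetry breaking-preserving game on $G$ is played by $\mathcal{A}$ and $\mathcal{B}$ who alternately color previously uncolored edges of $G$, $\mathcal{A}$ in red and $\mathcal{B}$ in blue, one edge per move, $\mathcal{A}$ first; round $i$ consists of $\mathcal{A}$'s move $a_i$ then $\mathcal{B}$'s move $b_i$; $A_i=\{a_1,\dots,a_i\}$, $B_i=\{b_1,\dots,b_i\}$ as subgraphs. Strategies: $a_i=S_1(b_1,\dots,b_{i-1})$, $b_i=S_2(a_1,\dots,a_i)$. $l(S_1,S_2)$ is the maximum $l\le\lfloor m/2\rfloor$ with $A_i\cong B_i$ for all $i\le l$, and $L(G)=\max_{S_2}\min_{S_1}l(S_1,S_2)$. *)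

theory Defs
  imports Main "HOL-Library.Ramsey"
begin

type_synonym 'v graph = "'v set \<times> 'v set set"

definition simple_graph :: "'v graph \<Rightarrow> bool" where
  "simple_graph G \<longleftrightarrow> finite (fst G) \<and> snd G \<subseteq> nsets (fst G) 2"

definition complete_graph :: "nat \<Rightarrow> nat graph" where
  "complete_graph n = ({..<n}, nsets {..<n} 2)"

lemma simple_graph_complete_graph: "simple_graph (complete_graph n)"
  by (simp add: simple_graph_def complete_graph_def)

definition graph_iso :: "'v graph \<Rightarrow> 'v graph \<Rightarrow> bool" where
  "graph_iso G H \<longleftrightarrow>
     (\<exists>f. bij_betw f (fst G) (fst H) \<and>
          (\<forall>u\<in>fst G. \<forall>v\<in>fst G. {u, v} \<in> snd G \<longleftrightarrow> {f u, f v} \<in> snd H))"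

text \<open>A set of edges as a subgraph has the endpoints of these edges as its vertices. Adding the
  remaining vertices of the ambient graph as isolated ones would not affect whether two such
  subgraphs of a finite graph are isomorphic.\<close>

definition edge_subgraph :: "'v set set \<Rightarrow> 'v graph" where
  "edge_subgraph F = (\<Union>F, F)"

text \<open>A strategy of either player is a function of the list of the opponent's moves so far.
  The own earlier moves are determined by it:
  \<open>A_moves S\<^sub>1 [b\<^sub>1, \<dots>, b\<^sub>i]\<close> is \<open>[a\<^sub>1, \<dots>, a\<^sub>i]\<close> and
  \<open>B_moves S\<^sub>2 [a\<^sub>1, \<dots>, a\<^sub>i]\<close> is \<open>[b\<^sub>1, \<dots>, b\<^sub>i]\<close>.\<close>

definition A_moves :: "('e list \<Rightarrow> 'e) \<Rightarrow> 'e list \<Rightarrow> 'e list" where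
  "A_moves S\<^sub>1 bs = map (\<lambda>k. S\<^sub>1 (take k bs)) [0..<length bs]"

definition B_moves :: "('e list \<Rightarrow> 'e) \<Rightarrow> 'e list \<Rightarrow> 'e list" where
  "B_moves S\<^sub>2 as = map (\<lambda>k. S\<^sub>2 (take (Suc k) as)) [0..<length as]"

text \<open>A function is a strategy if it colors an uncolored edge in every position that
  can arise from it and in which an uncolored edge is left. All moves made so far were
  legal iff they are distinct edges. The values in other positions are irrelevant.\<close>

definition A_strategy :: "'v graph \<Rightarrow> ('v set list \<Rightarrow> 'v set) \<Rightarrow> bool" where
  "A_strategy G S\<^sub>1 \<longleftrightarrow>
     (\<forall>bs. let h = A_moves S\<^sub>1 bs @ bs in
        distinct h \<and> set h \<subset> snd G \<longrightarrow> S\<^sub>1 bs \<in> snd G - set h)"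

definition B_strategy :: "'v graph \<Rightarrow> ('v set list \<Rightarrow> 'v set) \<Rightarrow> bool" where
  "B_strategy G S\<^sub>2 \<longleftrightarrow>
     (\<forall>as a. let h = B_moves S\<^sub>2 as @ as @ [a] in
        distinct h \<and> set h \<subset> snd G \<longrightarrow> S\<^sub>2 (as @ [a]) \<in> snd G - set h)"

text \<open>\<open>play S\<^sub>1 S\<^sub>2 i\<close> is \<open>([a\<^sub>1, \<dots>, a\<^sub>i], [b\<^sub>1, \<dots>, b\<^sub>i])\<close>.\<close>

fun play :: "('e list \<Rightarrow> 'e) \<Rightarrow> ('e list \<Rightarrow> 'e) \<Rightarrow> nat \<Rightarrow> 'e list \<times> 'e list" where
  "play S\<^sub>1 S\<^sub>2 0 = ([], [])"
| "play S\<^sub>1 S\<^sub>2 (Suc i) =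
     (let (as, bs) = play S\<^sub>1 S\<^sub>2 i; as' = as @ [S\<^sub>1 bs] in (as', bs @ [S\<^sub>2 as']))"

definition game_length ::
  "'v graph \<Rightarrow> ('v set list \<Rightarrow> 'v set) \<Rightarrow> ('v set list \<Rightarrow> 'v set) \<Rightarrow> nat" where
  "game_length G S\<^sub>1 S\<^sub>2 =
     Max {l. l \<le> card (snd G) div 2 \<and>
             (\<forall>i\<in>{1..l}. graph_iso (edge_subgraph (set (fst (play S\<^sub>1 S\<^sub>2 i))))
                                   (edge_subgraph (set (snd (play S\<^sub>1 S\<^sub>2 i)))))}"

definition game_value :: "'v graph \<Rightarrow> nat" where
  "game_value G =
     Max ((\<lambda>S\<^sub>2. Min ((\<lambda>S\<^sub>1. game_length G S\<^sub>1 S\<^sub>2) ` {S\<^sub>1. A_strategy G S\<^sub>1})) ` {S\<^sub>2. B_strategy G S\<^sub>2})"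

text \<open>The maxima and minima above are taken over nonempty finite sets, as the following lemmas show.\<close>

lemma game_length_le: "game_length G S\<^sub>1 S\<^sub>2 \<le> card (snd G) div 2"
proof -
  let ?M = "{l. l \<le> card (snd G) div 2 \<and>
             (\<forall>i\<in>{1..l}. graph_iso (edge_subgraph (set (fst (play S\<^sub>1 S\<^sub>2 i))))
                                   (edge_subgraph (set (snd (play S\<^sub>1 S\<^sub>2 i)))))}"
  have "0 \<in> ?M" by simp
  then have "?M \<noteq> {}" by blast
  moreover have "finite ?M" by (rule finite_subset[of _ "{..card (snd G) div 2}"]) auto
  ultimately have "Max ?M \<in> ?M" by (rule Max_in[rotated])
  then show ?thesis unfolding game_length_def by blast
qed

function some_free_A :: "'e set \<Rightarrow> 'e list \<Rightarrow> 'e" where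
  "some_free_A E bs =
     (SOME e. e \<in> E - set (map (\<lambda>k. some_free_A E (take k bs)) [0..<length bs] @ bs))"
  by pat_completeness auto
termination by (relation "measure (\<lambda>(E, bs). length bs)") auto

function some_free_B :: "'e set \<Rightarrow> 'e list \<Rightarrow> 'e" where
  "some_free_B E as =
     (SOME e. e \<in> E - set (map (\<lambda>k. some_free_B E (take (Suc k) as)) [0..<length as - 1] @ as))"
  by pat_completeness auto
termination by (relation "measure (\<lambda>(E, as). length as)") auto

declare some_free_A.simps [simp del] some_free_B.simps [simp del]

lemma A_strategy_exists: "\<exists>S\<^sub>1. A_strategy G S\<^sub>1"
proof
  show "A_strategy G (some_free_A (snd G))"
    unfolding A_strategy_def Let_def
  proof (intro allI impI, elim conjE)
    fix bs
    let ?h = "A_moves (some_free_A (snd G)) bs @ bs"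
    assume "set ?h \<subset> snd G"
    then have "\<exists>e. e \<in> snd G - set ?h" by blast
    then have "(SOME e. e \<in> snd G - set ?h) \<in> snd G - set ?h" by (rule someI_ex)
    moreover have "some_free_A (snd G) bs = (SOME e. e \<in> snd G - set ?h)"
      unfolding A_moves_def by (rule some_free_A.simps)
    ultimately show "some_free_A (snd G) bs \<in> snd G - set ?h" by simp
  qed
qed

lemma B_strategy_exists: "\<exists>S\<^sub>2. B_strategy G S\<^sub>2"
proof
  show "B_strategy G (some_free_B (snd G))"
    unfolding B_strategy_def Let_def
  proof (intro allI impI, elim conjE)
    fix as a
    let ?h = "B_moves (some_free_B (snd G)) as @ as @ [a]"
    assume "set ?h \<subset> snd G"
    then have "\<exists>e. e \<in> snd G - set ?h" by blast
    then have "(SOME e. e \<in> snd G - set ?h) \<in> snd G - set ?h" by (rule someI_ex)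
    moreover have "map (\<lambda>k. some_free_B (snd G) (take (Suc k) (as @ [a]))) [0..<length (as @ [a]) - 1]
        = B_moves (some_free_B (snd G)) as"
      unfolding B_moves_def by (rule map_cong) auto
    then have "some_free_B (snd G) (as @ [a]) = (SOME e. e \<in> snd G - set ?h)"
      by (subst some_free_B.simps) simp
    ultimately show "some_free_B (snd G) (as @ [a]) \<in> snd G - set ?h" by simp
  qed
qed

lemma finite_game_lengths:
  "finite ((\<lambda>S\<^sub>1. game_length G S\<^sub>1 S\<^sub>2) ` {S\<^sub>1. A_strategy G S\<^sub>1})"
proof (rule finite_subset[of _ "{..card (snd G) div 2}"])
  show "(\<lambda>S\<^sub>1. game_length G S\<^sub>1 S\<^sub>2) ` {S\<^sub>1. A_strategy G S\<^sub>1} \<subseteq> {..card (snd G) div 2}"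
    using game_length_le by (blast intro: atMost_iff[THEN iffD2])
qed simp

lemma finite_game_values:
  "finite ((\<lambda>S\<^sub>2. Min ((\<lambda>S\<^sub>1. game_length G S\<^sub>1 S\<^sub>2) ` {S\<^sub>1. A_strategy G S\<^sub>1})) ` {S\<^sub>2. B_strategy G S\<^sub>2})"
proof (rule finite_subset[of _ "{..card (snd G) div 2}"])
  have "Min ((\<lambda>S\<^sub>1. game_length G S\<^sub>1 S\<^sub>2) ` {S\<^sub>1. A_strategy G S\<^sub>1}) \<le> card (snd G) div 2" for S\<^sub>2
  proof -
    obtain S\<^sub>1 where "A_strategy G S\<^sub>1" using A_strategy_exists by blast
    then have "Min ((\<lambda>S\<^sub>1. game_length G S\<^sub>1 S\<^sub>2) ` {S\<^sub>1. A_strategy G S\<^sub>1}) \<le> game_length G S\<^sub>1 S\<^sub>2"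
      by (intro Min_le finite_game_lengths) auto
    then show ?thesis using game_length_le le_trans by blast
  qed
  then show "(\<lambda>S\<^sub>2. Min ((\<lambda>S\<^sub>1. game_length G S\<^sub>1 S\<^sub>2) ` {S\<^sub>1. A_strategy G S\<^sub>1})) ` {S\<^sub>2. B_strategy G S\<^sub>2}
    \<subseteq> {..card (snd G) div 2}" by auto
qed simp

end

(* For n <= 5 there are at most 10 edges, hence at most 5 rounds. For n >= 6 player A wins within 6
   rounds by an explicit strategy whose moves, after the first one, only use vertices touched
   before, so that the same strategy works for all n. The answers of B that keep the number of
   vertices and the sorted list of vertex degrees of the line graph equal to those of A are so few
   that the strategy is a tree with 69 nodes, which is verified by symbolic evaluation on vertices
   labelled in the order in which they are first touched. *)

theory Submission imports Defs "HOL-Library.Multiset" begin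

section \<open>Winning positions\<close>

text \<open>With \<open>A\<close> to move, some colouring within the next \<open>k\<close> rounds
  can be forced to be non-isomorphic. If no free edge is left for \<open>B\<close>, the quantifier
  over \<open>b\<close> is vacuous; the bound on \<open>K\<close> in \<open>game_value_less\<close>
  keeps such positions out of the play considered.\<close>

fun A_wins :: "'v set set \<Rightarrow> nat \<Rightarrow> 'v set set \<Rightarrow> 'v set set \<Rightarrow> bool" where
  "A_wins E 0 R B \<longleftrightarrow> False"
| "A_wins E (Suc k) R B \<longleftrightarrow> (\<exists>a \<in> E - (R \<union> B). \<forall>b \<in> E - (insert a R \<union> B).
     graph_iso (edge_subgraph (insert a R)) (edge_subgraph (insert b B)) \<longrightarrow>
     A_wins E k (insert a R) (insert b B))"

section \<open>Legality of the moves in a play\<close>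

lemma A_moves_snoc: "A_moves S\<^sub>1 (bs @ [b]) = A_moves S\<^sub>1 bs @ [S\<^sub>1 bs]"
  by (simp add: A_moves_def)

lemma B_moves_snoc: "B_moves S\<^sub>2 (as @ [a]) = B_moves S\<^sub>2 as @ [S\<^sub>2 (as @ [a])]"
  by (simp add: B_moves_def)

text \<open>The strict inequality leaves at least two uncoloured edges before the round, one for
  each player, so the strategy conditions apply to both moves.\<close>

lemma legal_round:
  assumes S: "A_strategy G S\<^sub>1" "B_strategy G S\<^sub>2"
    and less: "Suc (length as + length bs) < card (snd G)"
    and hist: "distinct (as @ bs)" "set (as @ bs) \<subseteq> snd G" "as = A_moves S\<^sub>1 bs" "bs = B_moves S\<^sub>2 as"
  defines "a \<equiv> S\<^sub>1 bs" and "b \<equiv> S\<^sub>2 (as @ [S\<^sub>1 bs])"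
  shows "a \<in> snd G - (set as \<union> set bs)" "b \<in> snd G - (insert a (set as) \<union> set bs)"
proof -
  have psub: "set h \<subset> snd G" if "set h \<subseteq> snd G" "length h < card (snd G)" for h
    using that card_length[of h] by (metis not_less psubsetI)
  have "set (as @ bs) \<subset> snd G"
    by (rule psub) (use less hist(2) in auto)
  then show a: "a \<in> snd G - (set as \<union> set bs)"
    using S(1) hist unfolding A_strategy_def Let_def a_def by (metis set_append)
  have "set (bs @ as @ [a]) \<subset> snd G"
    by (rule psub) (use less hist(2) a in auto)
  moreover have "distinct (bs @ as @ [a])"
    using hist(1) a by auto
  ultimately have "b \<in> snd G - set (bs @ as @ [a])"
    using S(2) hist(4) unfolding B_strategy_def Let_def b_def a_def by metis
  then show "b \<in> snd G - (insert a (set as) \<union> set bs)"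
    by auto
qed

text \<open>The last two conjuncts tie \<open>play\<close> to the histories \<open>A_moves\<close>
  and \<open>B_moves\<close> over which strategies are defined; they carry the induction.\<close>

lemma play_legal:
  assumes S: "A_strategy G S\<^sub>1" "B_strategy G S\<^sub>2"
    and "2 * i \<le> card (snd G)" "play S\<^sub>1 S\<^sub>2 i = (as, bs)"
  shows "length as = i \<and> length bs = i \<and> distinct (as @ bs) \<and> set (as @ bs) \<subseteq> snd G \<and>
    as = A_moves S\<^sub>1 bs \<and> bs = B_moves S\<^sub>2 as"
  using assms(3,4)
proof (induction i arbitrary: as bs)
  case 0
  then show ?case by (simp add: A_moves_def B_moves_def)
next
  case (Suc i)
  obtain as' bs' where eq: "play S\<^sub>1 S\<^sub>2 i = (as', bs')" by fastforce
  have le: "2 * i \<le> card (snd G)" using Suc.prems(1) by simp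
  have IH: "length as' = i" "length bs' = i" "distinct (as' @ bs')" "set (as' @ bs') \<subseteq> snd G"
    "as' = A_moves S\<^sub>1 bs'" "bs' = B_moves S\<^sub>2 as'"
    using Suc.IH[OF le eq] by - (elim conjE, assumption)+
  define a b where "a = S\<^sub>1 bs'" and "b = S\<^sub>2 (as' @ [a])"
  have ab: "as = as' @ [a]" "bs = bs' @ [b]"
    using Suc.prems(2) eq by (auto simp: a_def b_def Let_def)
  have "Suc (length as' + length bs') < card (snd G)"
    using IH(1,2) Suc.prems(1) by simp
  note legal = legal_round[OF S this IH(3-6), folded a_def, folded b_def]
  have hist: "as = A_moves S\<^sub>1 bs" "bs = B_moves S\<^sub>2 as"
    unfolding ab A_moves_snoc B_moves_snoc by (simp_all only: IH(5,6)[symmetric] a_def b_def)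
  have legal: "length as = Suc i" "length bs = Suc i" "distinct (as @ bs)" "set (as @ bs) \<subseteq> snd G"
    unfolding ab using legal IH(1-4) by auto
  show ?case by (intro conjI legal hist)
qed

text \<open>A strategy only sees the moves of the opponent; \<open>follow c\<close> recovers the own earlier moves for
  a choice \<open>c\<close> that depends on both move lists.\<close>

function follow :: "('e list \<Rightarrow> 'e list \<Rightarrow> 'e) \<Rightarrow> 'e list \<Rightarrow> 'e" where
  "follow c bs = c (map (\<lambda>k. follow c (take k bs)) [0..<length bs]) bs"
  by pat_completeness auto
termination by (relation "measure (\<lambda>(c, bs). length bs)") auto

declare follow.simps [simp del]

lemma follow_eq: "follow c bs = c (A_moves (follow c) bs) bs"
  unfolding A_moves_def by (rule follow.simps)

section \<open>From winning positions to a strategy and a bound\<close>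

definition winning_move :: "'v set set \<Rightarrow> nat \<Rightarrow> 'v set list \<Rightarrow> 'v set list \<Rightarrow> 'v set \<Rightarrow> bool" where
  "winning_move E k as bs a \<longleftrightarrow> (\<forall>b \<in> E - (insert a (set as) \<union> set bs).
     graph_iso (edge_subgraph (insert a (set as))) (edge_subgraph (insert b (set bs))) \<longrightarrow>
     A_wins E k (insert a (set as)) (insert b (set bs)))"

text \<open>One choice has to be legal everywhere, as \<open>A_strategy\<close> demands, and winning
  wherever the position is won. The number of remaining rounds is read off from the history as
  \<open>K - length bs\<close>.\<close>

definition choose_move :: "'v set set \<Rightarrow> nat \<Rightarrow> 'v set list \<Rightarrow> 'v set list \<Rightarrow> 'v set" where
  "choose_move E K as bs = (SOME a. a \<in> E - set (as @ bs) \<and>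
     (A_wins E (K - length bs) (set as) (set bs) \<longrightarrow> winning_move E (K - Suc (length bs)) as bs a))"

lemma choose_move:
  assumes "set (as @ bs) \<subset> E"
  shows "choose_move E K as bs \<in> E - set (as @ bs)"
    and "A_wins E (K - length bs) (set as) (set bs) \<Longrightarrow>
         winning_move E (K - Suc (length bs)) as bs (choose_move E K as bs)"
proof -
  have "\<exists>a. a \<in> E - set (as @ bs) \<and>
    (A_wins E (K - length bs) (set as) (set bs) \<longrightarrow> winning_move E (K - Suc (length bs)) as bs a)"
  proof (cases "A_wins E (K - length bs) (set as) (set bs)")
    case True
    \<comment> \<open>\<open>A_wins\<close> is false for 0 rounds, so the truncated difference is
      positive.\<close>
    then obtain k where k: "K - length bs = Suc k"
      by (metis A_wins.simps(1) not0_implies_Suc)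
    then have "K - Suc (length bs) = k" by simp
    with True k show ?thesis
      by (auto simp: winning_move_def)
  qed (use assms in blast)
  from someI_ex[OF this, folded choose_move_def]
  show "choose_move E K as bs \<in> E - set (as @ bs)"
    and "A_wins E (K - length bs) (set as) (set bs) \<Longrightarrow>
         winning_move E (K - Suc (length bs)) as bs (choose_move E K as bs)"
    by blast+
qed

text \<open>The value is a maximum over \<open>S\<^sub>2\<close> of minima over
  \<open>S\<^sub>1\<close>, so a single \<open>S\<^sub>1\<close> that beats every
  \<open>S\<^sub>2\<close> bounds all the minima. Always playing a winning move does this.\<close>

lemma game_value_less:
  assumes K: "2 * K \<le> card (snd G)" and wins: "A_wins (snd G) K {} {}"
  shows "game_value G < K"
proof -
  define S\<^sub>1 where "S\<^sub>1 = follow (choose_move (snd G) K)"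
  have S\<^sub>1: "A_strategy G S\<^sub>1"
    unfolding A_strategy_def Let_def
  proof (intro allI impI, elim conjE)
    fix bs assume "set (A_moves S\<^sub>1 bs @ bs) \<subset> snd G"
    from choose_move(1)[OF this, of K] show "S\<^sub>1 bs \<in> snd G - set (A_moves S\<^sub>1 bs @ bs)"
      unfolding S\<^sub>1_def by (subst follow_eq)
  qed
  have less: "game_length G S\<^sub>1 S\<^sub>2 < K" if S\<^sub>2: "B_strategy G S\<^sub>2" for S\<^sub>2
  proof -
    let ?iso = "\<lambda>i. graph_iso (edge_subgraph (set (fst (play S\<^sub>1 S\<^sub>2 i)))) (edge_subgraph (set (snd (play S\<^sub>1 S\<^sub>2 i))))"
    \<comment> \<open>Either the isomorphism has already failed, or the position is still won with
      \<open>K - i\<close> rounds left. At \<open>i = K\<close> the second alternative is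
      false.\<close>
    have inv: "(\<exists>j\<in>{1..i}. \<not> ?iso j) \<or>
        A_wins (snd G) (K - i) (set (fst (play S\<^sub>1 S\<^sub>2 i))) (set (snd (play S\<^sub>1 S\<^sub>2 i)))" if "i \<le> K" for i
      using that
    proof (induction i)
      case 0
      then show ?case using wins by simp
    next
      case (Suc i)
      show ?case
      proof (cases "\<exists>j\<in>{1..Suc i}. \<not> ?iso j")
        case False
        obtain as bs where eq: "play S\<^sub>1 S\<^sub>2 i = (as, bs)" by fastforce
        have le: "2 * i \<le> card (snd G)" using K Suc.prems by simp
        have legal: "length as = i" "length bs = i" "distinct (as @ bs)" "set (as @ bs) \<subseteq> snd G"
          "as = A_moves S\<^sub>1 bs" "bs = B_moves S\<^sub>2 as"
          using play_legal[OF S\<^sub>1 S\<^sub>2 le eq] by - (elim conjE, assumption)+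
        have W: "A_wins (snd G) (K - i) (set as) (set bs)"
          using Suc False eq by fastforce
        define a b where "a = S\<^sub>1 bs" and "b = S\<^sub>2 (as @ [a])"
        have eq': "play S\<^sub>1 S\<^sub>2 (Suc i) = (as @ [a], bs @ [b])"
          by (simp add: eq a_def b_def Let_def)
        have "Suc (length as + length bs) < card (snd G)"
          using K Suc.prems legal(1,2) by simp
        note new = legal_round[OF S\<^sub>1 S\<^sub>2 this legal(3-6), folded a_def, folded b_def]
        have "a = choose_move (snd G) K as bs"
          unfolding a_def using legal(5) by (metis S\<^sub>1_def follow_eq)
        moreover have "set (as @ bs) \<subset> snd G"
          using legal(4) new(1) by auto
        ultimately have "winning_move (snd G) (K - Suc i) as bs a"
          using choose_move(2)[of as bs "snd G" K] W by (simp only: legal(2))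
        moreover have "?iso (Suc i)" using False by (metis atLeastAtMost_iff le_add1 order_refl plus_1_eq_Suc)
        ultimately have "A_wins (snd G) (K - Suc i) (insert a (set as)) (insert b (set bs))"
          using new(2) unfolding winning_move_def eq' by simp
        then show ?thesis unfolding eq' by simp
      qed blast
    qed
    then obtain j where j: "j \<in> {1..K}" "\<not> ?iso j"
      using inv[of K] by auto
    let ?M = "{l. l \<le> card (snd G) div 2 \<and> (\<forall>i\<in>{1..l}. ?iso i)}"
    have "finite ?M" by (rule finite_subset[of _ "{..card (snd G) div 2}"]) auto
    moreover have "0 \<in> ?M" by simp
    moreover have "l < K" if "l \<in> ?M" for l
    proof (rule ccontr)
      assume "\<not> l < K"
      then have "j \<in> {1..l}" using j by simp
      then show False using that j by blast
    qed
    ultimately show ?thesis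
      unfolding game_length_def by (subst Max_less_iff) auto
  qed
  have "Min ((\<lambda>S\<^sub>1. game_length G S\<^sub>1 S\<^sub>2) ` {S\<^sub>1. A_strategy G S\<^sub>1}) < K" if "B_strategy G S\<^sub>2" for S\<^sub>2
    using Min_le[OF finite_game_lengths, of "game_length G S\<^sub>1 S\<^sub>2" G S\<^sub>2] S\<^sub>1 less[OF that] by auto
  then show ?thesis
    unfolding game_value_def
    using B_strategy_exists[of G] finite_game_values[of G] by (subst Max_less_iff) auto
qed

text \<open>Covers the small boards, which lack the edges for six full rounds.\<close>

lemma game_value_le: "game_value G \<le> card (snd G) div 2"
proof -
  have "Min ((\<lambda>S\<^sub>1. game_length G S\<^sub>1 S\<^sub>2) ` {S\<^sub>1. A_strategy G S\<^sub>1}) \<le> card (snd G) div 2" for S\<^sub>2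
  proof -
    obtain S\<^sub>1 where "A_strategy G S\<^sub>1" using A_strategy_exists by blast
    then have "Min ((\<lambda>S\<^sub>1. game_length G S\<^sub>1 S\<^sub>2) ` {S\<^sub>1. A_strategy G S\<^sub>1}) \<le> game_length G S\<^sub>1 S\<^sub>2"
      by (intro Min_le finite_game_lengths) auto
    then show ?thesis using game_length_le le_trans by blast
  qed
  then show ?thesis
    unfolding game_value_def
    using B_strategy_exists[of G] finite_game_values[of G] by (subst Max_le_iff) auto
qed

section \<open>An isomorphism invariant\<close>

text \<open>The second component consists of the degrees in the line graph, increased by one. The first
  component is needed to tell a triangle from a star with three edges.\<close>

definition edge_profile :: "'v set set \<Rightarrow> nat \<times> nat multiset" where
  "edge_profile F = (card (\<Union>F), image_mset (\<lambda>e. card {g \<in> F. e \<inter> g \<noteq> {}}) (mset_set F))"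

text \<open>An injection on the vertices acts injectively on the edges and preserves which edges
  meet.\<close>

lemma edge_profile_image:
  assumes inj: "inj_on f (\<Union>F)"
  shows "edge_profile ((`) f ` F) = edge_profile F"
proof -
  have injF: "inj_on ((`) f) F"
    by (rule inj_onI) (use inj in \<open>metis Union_upper inj_on_image_eq_iff\<close>)
  have card_meet: "card {g \<in> (`) f ` F. f ` e \<inter> g \<noteq> {}} = card {g \<in> F. e \<inter> g \<noteq> {}}" if "e \<in> F" for e
  proof -
    have "f ` e \<inter> f ` g = f ` (e \<inter> g)" if "g \<in> F" for g
      using \<open>e \<in> F\<close> that by (intro inj_on_image_Int[OF inj, symmetric]) auto
    then have "{g \<in> (`) f ` F. f ` e \<inter> g \<noteq> {}} = (`) f ` {g \<in> F. e \<inter> g \<noteq> {}}"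
      by auto
    also have "card \<dots> = card {g \<in> F. e \<inter> g \<noteq> {}}"
      by (intro card_image inj_on_subset[OF injF]) auto
    finally show ?thesis .
  qed
  have "\<Union>((`) f ` F) = f ` \<Union>F" by blast
  then have "card (\<Union>((`) f ` F)) = card (\<Union>F)"
    using card_image[OF inj] by simp
  moreover have "image_mset (\<lambda>e. card {g \<in> (`) f ` F. e \<inter> g \<noteq> {}}) (mset_set ((`) f ` F)) =
    image_mset (\<lambda>e. card {g \<in> F. e \<inter> g \<noteq> {}}) (mset_set F)"
  \<comment> \<open>For infinite \<open>F\<close> the image is infinite too, and
    \<open>mset_set\<close> is empty on both sides.\<close>
  proof (cases "finite F")
    case True
    have "image_mset (\<lambda>e. card {g \<in> (`) f ` F. e \<inter> g \<noteq> {}}) (mset_set ((`) f ` F)) =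
      image_mset (\<lambda>e. card {g \<in> (`) f ` F. f ` e \<inter> g \<noteq> {}}) (mset_set F)"
      by (simp add: image_mset_mset_set[OF injF, symmetric] multiset.map_comp comp_def)
    also have "\<dots> = image_mset (\<lambda>e. card {g \<in> F. e \<inter> g \<noteq> {}}) (mset_set F)"
      by (rule image_mset_cong) (use card_meet True in simp)
    finally show ?thesis .
  qed (simp add: finite_image_iff[OF injF])
  ultimately show ?thesis
    by (simp add: edge_profile_def)
qed

text \<open>As edges are doubletons, the vertex bijection carries \<open>F\<close> onto
  \<open>F'\<close>. This implication suffices for soundness: replies with equal profile that are
  not isomorphic merely add cases which the strategy must answer.\<close>

lemma graph_iso_edge_profile:
  assumes iso: "graph_iso (edge_subgraph F) (edge_subgraph F')"
    and F: "\<And>e. e \<in> F \<Longrightarrow> card e = 2" "\<And>e. e \<in> F' \<Longrightarrow> card e = 2"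
  shows "edge_profile F = edge_profile F'"
proof -
  obtain f where bij: "bij_betw f (\<Union>F) (\<Union>F')"
    and iff: "\<And>u v. u \<in> \<Union>F \<Longrightarrow> v \<in> \<Union>F \<Longrightarrow> {u, v} \<in> F \<longleftrightarrow> {f u, f v} \<in> F'"
    using iso unfolding graph_iso_def edge_subgraph_def fst_conv snd_conv by blast
  have "(`) f ` F = F'"
  proof (intro equalityI subsetI)
    fix e' assume "e' \<in> (`) f ` F"
    then obtain e where e: "e \<in> F" "e' = f ` e" by blast
    then obtain u v where "e = {u, v}" using F(1) by (metis card_2_iff)
    with e iff[of u v] show "e' \<in> F'" by auto
  next
    fix e' assume e': "e' \<in> F'"
    then obtain x y where xy: "e' = {x, y}" using F(2) by (metis card_2_iff)
    with e' bij obtain u v where "u \<in> \<Union>F" "v \<in> \<Union>F" "x = f u" "y = f v"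
      unfolding bij_betw_def by (smt (verit) UnionI imageE insertI1 insertI2)
    with e' xy iff[of u v] have "{u, v} \<in> F" "e' = f ` {u, v}" by auto
    then show "e' \<in> (`) f ` F" by blast
  qed
  then show ?thesis
    using edge_profile_image[of f F] bij by (auto simp: bij_betw_def)
qed

section \<open>Checking a strategy on labelled vertices\<close>

text \<open>Increasing pairs represent each edge once. The ordering by larger endpoint fixes the
  order of \<open>replies\<close>, hence that of the subtrees in
  \<open>breaking_strategy\<close>.\<close>

definition pairs :: "nat \<Rightarrow> (nat \<times> nat) list" where
  "pairs t = concat (map (\<lambda>j. map (\<lambda>i. (i, j)) [0..<j]) [0..<t])"

definition edge :: "(nat \<Rightarrow> 'v) \<Rightarrow> nat \<times> nat \<Rightarrow> 'v set" where
  "edge f e = {f (fst e), f (snd e)}"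

definition meets :: "nat \<times> nat \<Rightarrow> nat \<times> nat \<Rightarrow> bool" where
  "meets e g \<longleftrightarrow> fst e = fst g \<or> fst e = snd g \<or> snd e = fst g \<or> snd e = snd g"

text \<open>Executable form of \<open>edge_profile\<close>; sorting stands in for the
  multiset.\<close>

definition profile :: "(nat \<times> nat) list \<Rightarrow> nat \<times> nat list" where
  "profile es = (length (remdups (map fst es @ map snd es)),
     sort (map (\<lambda>e. length (filter (meets e) es)) es))"

text \<open>The touched vertices have the labels below \<open>t\<close>. Up to relabelling, an edge with untouched
  endpoints uses \<open>t\<close>, or \<open>t\<close> and \<open>Suc t\<close>, for them.\<close>

definition replies :: "nat \<Rightarrow> (nat \<times> nat) list \<Rightarrow> (nat \<times> nat) list \<Rightarrow> (nat \<times> nat) list" where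
  "replies t rs bs = filter (\<lambda>b. b \<notin> set (rs @ bs) \<and> profile (b # bs) = profile rs)
     (pairs (Suc t) @ [(t, Suc t)])"

text \<open>The subtrees of a node belong to the members of \<open>replies\<close>, in the same order.\<close>

datatype strategy = Move nat nat "strategy list"

text \<open>After a reply \<open>b\<close> the number of labels in use is \<open>t\<close>,
  \<open>t + 1\<close> or \<open>t + 2\<close>, which \<open>max t (Suc (snd b))\<close> computes.
  Red moves stay below \<open>t\<close>, so fresh vertices are introduced by \<open>B\<close> alone.
  An empty list of subtrees is accepted exactly if no reply keeps the profile, that is, if
  \<open>A\<close> has won.\<close>

fun wins :: "nat \<Rightarrow> strategy \<Rightarrow> nat \<Rightarrow> (nat \<times> nat) list \<Rightarrow> (nat \<times> nat) list \<Rightarrow> bool" where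
  "wins 0 s t rs bs \<longleftrightarrow> False"
| "wins (Suc k) (Move i j ss) t rs bs \<longleftrightarrow> i < j \<and> j < t \<and> (i, j) \<notin> set (rs @ bs) \<and>
     list_all2 (\<lambda>s b. wins k s (max t (Suc (snd b))) ((i, j) # rs) (b # bs)) ss
       (replies t ((i, j) # rs) bs)"

section \<open>Transfer from labels to vertices\<close>

lemma set_pairs: "e \<in> set (pairs t) \<longleftrightarrow> fst e < snd e \<and> snd e < t"
  by (cases e) (auto simp: pairs_def image_iff Bex_def)

lemma inj_on_edge:
  assumes "inj_on f {..<t}"
  shows "inj_on (edge f) (set (pairs t))"
proof (rule inj_onI)
  fix e g assume "e \<in> set (pairs t)" "g \<in> set (pairs t)" "edge f e = edge f g"
  with assms show "e = g"
    by (cases e; cases g) (auto simp: set_pairs edge_def doubleton_eq_iff inj_on_eq_iff)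
qed

lemma edge_Int_edge:
  assumes "inj_on f {..<t}" "e \<in> set (pairs t)" "g \<in> set (pairs t)"
  shows "edge f e \<inter> edge f g \<noteq> {} \<longleftrightarrow> meets e g"
  using assms by (auto simp: set_pairs edge_def meets_def inj_on_eq_iff)

text \<open>Under an injective labelling \<open>meets\<close> is nonempty intersection, and
  distinctness lets list lengths count edges; \<open>mset\<close> forgets the sorting.\<close>

lemma edge_profile_edge:
  assumes inj: "inj_on f {..<t}" and es: "set es \<subseteq> set (pairs t)" "distinct es"
  shows "edge_profile (edge f ` set es) = map_prod id mset (profile es)"
proof -
  have inj': "inj_on (edge f) (set es)"
    using inj_on_edge[OF inj] es(1) by (rule inj_on_subset)
  have "\<Union>(edge f ` set es) = f ` set (map fst es @ map snd es)"
    by (auto simp: edge_def)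
  moreover have "inj_on f (set (map fst es @ map snd es))"
    by (rule inj_on_subset[OF inj]) (use es(1) in \<open>fastforce simp: set_pairs\<close>)
  ultimately have "card (\<Union>(edge f ` set es)) = length (remdups (map fst es @ map snd es))"
    by (simp only: card_image length_remdups_card_conv)
  moreover have "card {g \<in> edge f ` set es. edge f e \<inter> g \<noteq> {}} = length (filter (meets e) es)"
    if "e \<in> set es" for e
  proof -
    have "{g \<in> edge f ` set es. edge f e \<inter> g \<noteq> {}} = edge f ` set (filter (meets e) es)"
    proof -
      have "edge f e \<inter> edge f g \<noteq> {} \<longleftrightarrow> meets e g" if "g \<in> set es" for g
        using es(1) that \<open>e \<in> set es\<close> by (intro edge_Int_edge[OF inj]) auto
      then show ?thesis by auto
    qed
    also have "card \<dots> = card (set (filter (meets e) es))"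
      by (intro card_image inj_on_subset[OF inj']) auto
    also have "\<dots> = length (filter (meets e) es)"
      by (intro distinct_card distinct_filter es(2))
    finally show ?thesis .
  qed
  then have "image_mset (\<lambda>e. card {g \<in> edge f ` set es. e \<inter> g \<noteq> {}}) (mset_set (edge f ` set es)) =
    mset (map (\<lambda>e. length (filter (meets e) es)) es)"
    by (simp add: image_mset_mset_set[OF inj', symmetric] mset_set_set[OF es(2)] multiset.map_comp
        comp_def) (rule image_mset_cong, simp)
  ultimately show ?thesis
    by (simp add: edge_profile_def profile_def)
qed

lemma profile_eqI: "map_prod id mset (profile es) = map_prod id mset (profile es') \<Longrightarrow> profile es = profile es'"
  by (auto simp: profile_def intro: properties_for_sort)

text \<open>An edge has zero, one or two unlabelled endpoints, and these receive the next free
  labels. Hence finitely many labelled replies cover all edges on a vertex set \<open>V\<close> of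
  any size.\<close>

lemma extend_labelling:
  assumes inj: "inj_on f {..<t}" and f: "f ` {..<t} \<subseteq> V" and b: "b \<in> nsets V 2"
  obtains f' q where "q \<in> set (pairs (Suc t) @ [(t, Suc t)])"
    "inj_on f' {..<max t (Suc (snd q))}" "f' ` {..<max t (Suc (snd q))} \<subseteq> V"
    "\<And>i. i < t \<Longrightarrow> f' i = f i" "edge f' q = b"
proof -
  obtain x y where b: "b = {x, y}" "x \<noteq> y" "x \<in> V" "y \<in> V"
    using b by (auto simp: nsets_2_eq)
  consider (old) i j where "i < j" "j < t" "b = {f i, f j}"
    | (mixed) i z where "i < t" "z \<in> V - f ` {..<t}" "b = {f i, z}"
    | (new) "x \<notin> f ` {..<t}" "y \<notin> f ` {..<t}"
    using b by (smt (verit) Diff_iff imageE insert_commute lessThan_iff linorder_neqE_nat)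
  then show thesis
  proof cases
    case old
    then have "max t (Suc j) = t" by simp
    with old inj f show thesis
      by (intro that[of "(i, j)" f]) (auto simp: set_pairs edge_def)
  next
    case mixed
    with inj f show thesis
      by (intro that[of "(i, t)" "f(t := z)"])
         (auto simp: set_pairs edge_def lessThan_Suc inj_on_def)
  next
    case new
    with inj f b show thesis
      by (intro that[of "(t, Suc t)" "f(t := x, Suc t := y)"])
         (auto simp: set_pairs edge_def lessThan_Suc inj_on_def)
  qed
qed

lemma edge_image_cong:
  assumes "\<And>i. i < t \<Longrightarrow> f' i = f i" "X \<subseteq> set (pairs t)"
  shows "edge f' ` X = edge f ` X"
  using assms by (intro image_cong refl) (force simp: edge_def set_pairs subset_iff)

text \<open>Induction with \<open>f\<close> arbitrary, since every reply may extend the labelling. A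
  reply that keeps the graphs isomorphic gets a label \<open>q\<close> with the profile of the red
  edges, so \<open>q\<close> occurs in \<open>replies\<close> and its subtree wins by
  induction.\<close>

lemma wins_sound:
  assumes "wins k s t rs bs" and "inj_on f {..<t}" "f ` {..<t} \<subseteq> V"
    and "set (rs @ bs) \<subseteq> set (pairs t)" "distinct (rs @ bs)"
  shows "A_wins (nsets V 2) k (edge f ` set rs) (edge f ` set bs)"
  using assms
proof (induction k arbitrary: s t rs bs f)
  case 0
  then show ?case by simp
next
  case (Suc k)
  obtain i j ss where s: "s = Move i j ss" by (cases s)
  let ?rs = "(i, j) # rs"
  note wins = Suc.prems(1)[unfolded s wins.simps]
  have inj_edge: "inj_on (edge f) (set (pairs t))"
    using Suc.prems(2) by (rule inj_on_edge)
  have edge_mem: "edge f ` set (pairs t) \<subseteq> nsets V 2"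
    using Suc.prems(2,3) by (force simp: edge_def set_pairs nsets_2_eq inj_on_eq_iff)
  have pairs: "set (?rs @ bs) \<subseteq> set (pairs t)" and dist: "distinct (?rs @ bs)"
    using wins Suc.prems(4,5) by (auto simp: set_pairs)
  show ?case
    unfolding A_wins.simps
  proof (rule bexI[of _ "edge f (i, j)"], intro ballI impI)
    have "edge f (i, j) \<notin> edge f ` set (rs @ bs)"
      using wins pairs by (subst inj_on_image_mem_iff[OF inj_edge]) auto
    then show "edge f (i, j) \<in> nsets V 2 - (edge f ` set rs \<union> edge f ` set bs)"
      using edge_mem pairs by auto
  next
    fix b
    assume b: "b \<in> nsets V 2 - (insert (edge f (i, j)) (edge f ` set rs) \<union> edge f ` set bs)"
      and iso: "graph_iso (edge_subgraph (insert (edge f (i, j)) (edge f ` set rs)))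
        (edge_subgraph (insert b (edge f ` set bs)))"
    then have "b \<in> nsets V 2" by blast
    then obtain f' q where q: "q \<in> set (pairs (Suc t) @ [(t, Suc t)])" "edge f' q = b"
      and f': "inj_on f' {..<max t (Suc (snd q))}" "f' ` {..<max t (Suc (snd q))} \<subseteq> V"
        "\<And>i. i < t \<Longrightarrow> f' i = f i"
      using extend_labelling[OF Suc.prems(2,3)] by metis
    let ?t = "max t (Suc (snd q))"
    have cong: "edge f' ` X = edge f ` X" if "X \<subseteq> set (pairs t)" for X
      by (rule edge_image_cong[OF _ that]) (rule f'(3))
    \<comment> \<open>Extending the labelling does not move the edges coloured so far.\<close>
    have eq: "edge f' ` set ?rs = insert (edge f (i, j)) (edge f ` set rs)"
      "edge f' ` set bs = edge f ` set bs"
      using cong[of "set ?rs"] cong[of "set bs"] cong[of "{(i, j)}"] pairs by simp_all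
    have new_edges: "edge f' ` set (q # bs) = insert b (edge f ` set bs)"
      by (simp add: eq q(2))
    have pairs': "set (?rs @ q # bs) \<subseteq> set (pairs ?t)"
      using pairs q(1) by (auto simp: set_pairs less_max_iff_disj)
    have "edge f' q \<notin> edge f' ` set ?rs \<union> edge f' ` set bs"
      using b unfolding eq q(2) by blast
    then have "q \<notin> set (?rs @ bs)"
      by (metis image_Un imageI set_append)
    \<comment> \<open>The isomorphism is used here: it equates the profiles of the actual edge sets,
      which are those of the labelled lists.\<close>
    moreover have "profile (q # bs) = profile ?rs"
    proof (rule profile_eqI)
      have "card e = 2" if "e \<in> insert (edge f (i, j)) (edge f ` set rs) \<union> insert b (edge f ` set bs)" for e
      proof -
        have "e \<in> nsets V 2" using that edge_mem pairs \<open>b \<in> nsets V 2\<close> by auto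
        then show ?thesis by (simp add: nsets_def)
      qed
      then have "edge_profile (edge f' ` set ?rs) = edge_profile (edge f' ` set (q # bs))"
        unfolding eq new_edges by (intro graph_iso_edge_profile[OF iso]) blast+
      moreover have "edge_profile (edge f' ` set ?rs) = map_prod id mset (profile ?rs)"
        by (rule edge_profile_edge[OF f'(1)]) (use pairs' dist in auto)
      moreover have "edge_profile (edge f' ` set (q # bs)) = map_prod id mset (profile (q # bs))"
        by (rule edge_profile_edge[OF f'(1)]) (use pairs' dist \<open>q \<notin> set (?rs @ bs)\<close> in auto)
      ultimately show "map_prod id mset (profile (q # bs)) = map_prod id mset (profile ?rs)"
        by simp
    qed
    ultimately have "q \<in> set (replies t ?rs bs)"
      using q(1) unfolding replies_def set_filter by blast
    \<comment> \<open>The position of \<open>q\<close> among the replies is that of its subtree in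
      \<open>ss\<close>.\<close>
    then obtain m where "m < length (replies t ?rs bs)" "replies t ?rs bs ! m = q"
      by (metis in_set_conv_nth)
    moreover have "list_all2 (\<lambda>s b. wins k s (max t (Suc (snd b))) ?rs (b # bs)) ss (replies t ?rs bs)"
      using wins by blast
    ultimately have "wins k (ss ! m) ?t ?rs (q # bs)"
      using list_all2_nthD2 by fastforce
    then have "A_wins (nsets V 2) k (edge f' ` set ?rs) (edge f' ` set (q # bs))"
      using f'(1,2) pairs' by (rule Suc.IH) (use dist \<open>q \<notin> set (?rs @ bs)\<close> in auto)
    then show "A_wins (nsets V 2) k (insert (edge f (i, j)) (edge f ` set rs)) (insert b (edge f ` set bs))"
      by (simp only: eq new_edges)
  qed
qed

text \<open>Found by computer search.\<close>

definition breaking_strategy :: strategy where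
  "breaking_strategy =
    Move 0 1 [
      Move 1 2 [
        Move 1 3 [
          Move 2 4 [
            Move 3 4 [],
            Move 2 3 [],
            Move 3 4 [Move 2 3 [], Move 2 3 []],
            Move 3 4 [Move 2 3 [], Move 2 3 []]]],
        Move 1 3 [
          Move 0 4 [
            Move 3 4 [],
            Move 0 3 [],
            Move 3 4 [Move 0 3 [], Move 0 3 []],
            Move 3 4 [Move 0 3 [], Move 0 3 []]]]],
      Move 0 2 [
        Move 0 3 [
          Move 2 4 [
            Move 3 4 [],
            Move 2 3 [],
            Move 3 4 [Move 2 3 [], Move 2 3 []],
            Move 3 4 [Move 2 3 [], Move 2 3 []]]],
        Move 0 3 [
          Move 1 4 [
            Move 3 4 [],
            Move 1 3 [],
            Move 3 4 [Move 1 3 [], Move 1 3 []],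
            Move 3 4 [Move 1 3 [], Move 1 3 []]]]],
      Move 0 2 [
        Move 0 3 [
          Move 1 4 [
            Move 3 4 [],
            Move 1 3 [],
            Move 3 4 [Move 1 3 [], Move 1 3 []],
            Move 3 4 [Move 1 3 [], Move 1 3 []]]],
        Move 1 2 [],
        Move 1 2 [],
        Move 3 4 [Move 1 2 [], Move 1 2 [], Move 1 2 []],
        Move 1 4 [
          Move 2 4 [],
          Move 2 4 [],
          Move 2 4 [Move 1 2 [Move 0 4 []]],
          Move 2 4 [Move 1 2 [Move 0 4 []]]]]]"

text \<open>The value \<open>t = 2\<close> makes labels 0 and 1 available for the first move. The
  root's subtrees answer the replies (0,2), (1,2) and (2,3); swapping 0 and 1 exchanges the first
  two. In the two lines ending with \<open>Move 0 4\<close>, red completes a complete graph on 0, 1,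
  2, 4, while blue would need the edge (2,4), which is already red.\<close>

lemma wins_breaking_strategy: "wins 6 breaking_strategy 2 [] []"
  by code_simp

section \<open>The bound for small and large boards\<close>

theorem theorem4p1:
  fixes n :: nat
  assumes "n \<ge> 1"
  shows "game_value (complete_graph n) \<le> 6"
proof (cases "n \<le> 5")
  case True
  have "card (snd (complete_graph n)) = n choose 2"
    by (simp add: complete_graph_def)
  also have "\<dots> \<le> 5 choose 2"
    using True by (rule binomial_right_mono)
  finally show ?thesis
    using game_value_le[of "complete_graph n"] by (simp add: choose_two)
next
  case False
  \<comment> \<open>There are at least 15 edges, enough for the 12 moves of six rounds.\<close>
  have "6 choose 2 \<le> n choose 2"
    using False by (intro binomial_right_mono) simp
  also have "n choose 2 = card (snd (complete_graph n))"
    by (simp add: complete_graph_def)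
  finally have "2 * 6 \<le> card (snd (complete_graph n))"
    by (simp add: choose_two)
  moreover have "A_wins (snd (complete_graph n)) 6 {} {}"
    \<comment> \<open>The identity sends the initial labels 0 and 1 to vertices of the graph, as
      \<open>n \<ge> 6\<close>.\<close>
    using wins_sound[OF wins_breaking_strategy, of id "{..<n}"] False
    by (auto simp: complete_graph_def)
  ultimately show ?thesis
    \<comment> \<open>The isomorphism fails by round 6 at the latest, so the bound obtained is
      strict.\<close>
    using game_value_less[of 6 "complete_graph n"] by simp
qed

end
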